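(* Every cube tiling of $\mathbb{R}^{2}$ contains a column. That is, if $T\subseteq\mathbb{R}^2$ is such that the cubes $[0,1)^2+t$, $t\in T$, are pairwise disjoint (for distinct $t\in T$) and their union is $\mathbb{R}^2$, then there exist $s\in\mathbb{R}^2$ and $i\in\{1,2\}$ such that $s+ke_i\in T$ for every $k\in\mathbb{Z}$, where $e_i$ is the $i$-th element of the standard basis of $\mathbb{R}^2$.
   Context: For $T\subseteq\mathbb{R}^n$, the family $[0,1)^n+T=\{[0,1)^n+t\colon t\in T\}$ is a cube tiling of $\mathbb{R}^n$ if for each pair of distinct $s,t\in T$ the cubes $[0,1)^n+s$ and $[0,1)^n+t$ are disjoint and $\bigcup_{t\in T}([0,1)^n+t)=\mathbb{R}^n$. No periodicity or lattice assumption is made on $T$. A column is a family of cubes of the form $\{[0,1)^n+(s+ke_i)\colon k\in\mathbb{Z}\}$, where $s\in\mathbb{R}^n$ and $e_i$ is an element of the standard basis of $\mathbb{R}^n$; a tiling contains a column if all the cubes of some column belong to the tiling. *)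

theory Defs
  imports "HOL-Analysis.Analysis"
begin

(* The order interval {0..<1} of the componentwise order on vectors is not the half-open
   cube: 0 < 1 only requires strictness in some coordinate. Hence the explicit components. *)
definition unit_cube :: "(real ^ 'n) set"
  where "unit_cube = {x. \<forall>i. 0 \<le> x $ i \<and> x $ i < 1}"

definition cube :: "real ^ 'n \<Rightarrow> (real ^ 'n) set"
  where "cube t = (\<lambda>x. x + t) ` unit_cube"

definition cube_tiling :: "(real ^ 'n) set \<Rightarrow> bool"
  where "cube_tiling T \<longleftrightarrow> disjoint_family_on cube T \<and> (\<Union>t\<in>T. cube t) = UNIV"

definition column :: "real ^ 'n \<Rightarrow> 'n \<Rightarrow> (real ^ 'n) set set"
  where "column s i = {cube (s + of_int k *\<^sub>R axis i 1) | k :: int. True}"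

lemma mem_cube_iff: "x \<in> cube t \<longleftrightarrow> (\<forall>i. t $ i \<le> x $ i \<and> x $ i < t $ i + 1)"
proof -
  have "x \<in> cube t \<longleftrightarrow> x - t \<in> unit_cube"
    unfolding cube_def by (metis (no_types, lifting) add_diff_cancel diff_add_cancel image_iff)
  also have "\<dots> \<longleftrightarrow> (\<forall>i. t $ i \<le> x $ i \<and> x $ i < t $ i + 1)"
    unfolding unit_cube_def by (auto simp: algebra_simps)
  finally show ?thesis .
qed

lemma inj_cube: "inj cube"
proof (rule injI)
  fix s t :: "real ^ 'n"
  assume eq: "cube s = cube t"
  have "s \<in> cube s" "t \<in> cube t" by (simp_all add: mem_cube_iff)
  with eq have "s \<in> cube t" "t \<in> cube s" by simp_all
  then show "s = t" by (auto simp: mem_cube_iff vec_eq_iff intro: order.antisym)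
qed

(* A tiling contains a column as a subfamily of its cubes iff the translation vectors
   of the column all belong to T. *)
lemma column_subset_iff:
  "column s i \<subseteq> cube ` T \<longleftrightarrow> (\<forall>k :: int. s + of_int k *\<^sub>R axis i 1 \<in> T)"
proof -
  have "column s i \<subseteq> cube ` T \<longleftrightarrow>
      (\<forall>k :: int. cube (s + of_int k *\<^sub>R axis i 1) \<in> cube ` T)"
    unfolding column_def by blast
  then show ?thesis by (simp add: inj_image_mem_iff[OF inj_cube])
qed

end

theory Submission
  imports Defs
begin

text \<open>
  The whole argument rests on the rigidity of dimension one: if the intervals \<open>[s, s + 1)\<close>
  tile the line, then the set of their left endpoints is a coset of the integers
  (\<open>interval_tiling_shift\<close>, \<open>interval_tiling_diff_Ints\<close>). A line
  parallel to a coordinate axis is cut by the cubes of a tiling into such intervals, so all the cubes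
  that meet this line have the same coordinate modulo 1 in the direction of the line.

  In the plane, start with a square \<open>t\<close> of the tiling and consider the row of squares that meet
  the horizontal line through its lower edge. By rigidity these have the first coordinates
  \<open>t\<^sub>1 + k\<close>, and their second coordinates lie in a half-open interval of length 1. If all of them
  are equal, then the row is a column in the horizontal direction. Otherwise two consecutive squares
  of the row are shifted vertically against each other by a non-integer. The vertical lines just left
  and just right of their common edge then carry different cosets of the integers, and no square can
  cross this edge line at any height. The squares on its left therefore all have their right edges on it
  and form a column in the vertical direction (\<open>column_at_noninteger_shift\<close>).
\<close>

definition interval_tiling :: "real set \<Rightarrow> bool"
  where "interval_tiling S \<longleftrightarrow> (\<forall>x. \<exists>!s. s \<in> S \<and> s \<le> x \<and> x < s + 1)"

lemma interval_tiling_cover: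
  assumes "interval_tiling S"
  obtains s where "s \<in> S" "s \<le> x" "x < s + 1"
  using assms unfolding interval_tiling_def by blast

lemma interval_tiling_unique:
  assumes "interval_tiling S" "s \<in> S" "s \<le> x" "x < s + 1" "s' \<in> S" "s' \<le> x" "x < s' + 1"
  shows "s = s'"
  using assms unfolding interval_tiling_def by blast

lemma interval_tiling_succ:
  assumes "interval_tiling S" "s \<in> S"
  shows "s + 1 \<in> S"
proof -
  obtain s' where s': "s' \<in> S" "s' \<le> s + 1" "s + 1 < s' + 1"
    using interval_tiling_cover[OF assms(1)] .
  have "s' = s" if "s' < s + 1"
    using interval_tiling_unique[OF assms, of s' s'] s' that by simp
  with s' have "s' = s + 1" by linarith
  with s' show ?thesis by simp
qed

lemma interval_tiling_pred:
  assumes "interval_tiling S" "s \<in> S"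
  shows "s - 1 \<in> S"
proof -
  obtain s' where s': "s' \<in> S" "s' \<le> s - 1" "s - 1 < s' + 1"
    using interval_tiling_cover[OF assms(1)] .
  have "s' + 1 = s"
    by (rule interval_tiling_unique[OF assms(1), of _ s])
      (use s' assms(2) interval_tiling_succ[OF assms(1) s'(1)] in auto)
  with s' show ?thesis by auto
qed

lemma interval_tiling_shift:
  assumes "interval_tiling S" "s \<in> S"
  shows "s + of_int k \<in> S"
proof (induction k rule: int_induct[where k = 0])
  case base
  show ?case using assms(2) by simp
next
  case (step1 i)
  then show ?case using interval_tiling_succ[OF assms(1)] by (force simp: add.assoc)
next
  case (step2 i)
  then show ?case using interval_tiling_pred[OF assms(1)] by (force simp: algebra_simps)
qed

text \<open>The integer translate of \<open>[s, s + 1)\<close> that contains \<open>s'\<close> belongs to the tiling, so it is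
  the interval that starts in \<open>s'\<close>.\<close>

lemma interval_tiling_diff_Ints:
  assumes "interval_tiling S" "s \<in> S" "s' \<in> S"
  shows "s' - s \<in> \<int>"
proof -
  have "s + of_int \<lfloor>s' - s\<rfloor> = s'"
    by (rule interval_tiling_unique[OF assms(1), of _ s'])
      (use interval_tiling_shift[OF assms(1,2)] assms(3) in \<open>auto, linarith+\<close>)
  then have "s' - s = of_int \<lfloor>s' - s\<rfloor>" by linarith
  then show ?thesis by (metis Ints_of_int)
qed

lemma cube_tiling_unique:
  assumes "cube_tiling T" "t \<in> T" "u \<in> T" "x \<in> cube t" "x \<in> cube u"
  shows "t = u"
  using assms unfolding cube_tiling_def disjoint_family_on_def by blast

text \<open>The line through \<open>p\<close> in direction \<open>j\<close> is either disjoint from a cube or cut by it in an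
  interval of length 1, and each point of the line lies in exactly one cube.\<close>

lemma cube_tiling_line_section:
  assumes "cube_tiling T"
  shows "interval_tiling ((\<lambda>t. t $ j) `
    {t \<in> T. \<forall>i. i \<noteq> j \<longrightarrow> t $ i \<le> p $ i \<and> p $ i < t $ i + 1})" (is "interval_tiling (_ ` ?L)")
  unfolding interval_tiling_def
proof
  fix x :: real
  define q where "q = (\<chi> i. if i = j then x else p $ i)"
  have q: "q \<in> cube t \<longleftrightarrow>
      (\<forall>i. i \<noteq> j \<longrightarrow> t $ i \<le> p $ i \<and> p $ i < t $ i + 1) \<and> t $ j \<le> x \<and> x < t $ j + 1" for t
    unfolding mem_cube_iff q_def by auto
  from assms obtain t where t: "t \<in> T" "q \<in> cube t"
    unfolding cube_tiling_def by blast
  show "\<exists>!s. s \<in> (\<lambda>t. t $ j) ` ?L \<and> s \<le> x \<and> x < s + 1"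
  proof (rule ex1I[of _ "t $ j"])
    show "t $ j \<in> (\<lambda>t. t $ j) ` ?L \<and> t $ j \<le> x \<and> x < t $ j + 1"
      using t q by auto
  next
    fix s assume "s \<in> (\<lambda>t. t $ j) ` ?L \<and> s \<le> x \<and> x < s + 1"
    then obtain u where "u \<in> T" "q \<in> cube u" "s = u $ j" using q by auto
    then show "s = t $ j" using cube_tiling_unique[OF assms t(1) _ t(2)] by blast
  qed
qed

lemma index_2_cases: "i \<noteq> j \<Longrightarrow> l = i \<or> l = j" for i j l :: 2
  by (metis exhaust_2)

lemma square_tiling_line_section:
  fixes T :: "(real ^ 2) set"
  assumes "cube_tiling T" "i \<noteq> j"
  shows "interval_tiling ((\<lambda>t. t $ j) ` {t \<in> T. t $ i \<le> x \<and> x < t $ i + 1})"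
proof -
  have "(\<forall>l. l \<noteq> j \<longrightarrow> Q l) \<longleftrightarrow> Q i" for Q
    using assms(2) index_2_cases[OF assms(2)] by metis
  then show ?thesis
    using cube_tiling_line_section[OF assms(1), of j "\<chi> l. x"] by simp
qed

lemma square_tiling_line_shift:
  fixes T :: "(real ^ 2) set"
  assumes "cube_tiling T" "i \<noteq> j" "t \<in> T" "t $ i \<le> x" "x < t $ i + 1"
  obtains u where "u \<in> T" "u $ i \<le> x" "x < u $ i + 1" "u $ j = t $ j + of_int k"
proof -
  have "t $ j + of_int k \<in> (\<lambda>t. t $ j) ` {t \<in> T. t $ i \<le> x \<and> x < t $ i + 1}"
    by (rule interval_tiling_shift[OF square_tiling_line_section[OF assms(1,2)]])
      (use assms(3-5) in auto)
  with that show thesis by auto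
qed

lemma square_tiling_line_diff_Ints:
  fixes T :: "(real ^ 2) set"
  assumes "cube_tiling T" "i \<noteq> j" "t \<in> T" "t $ i \<le> x" "x < t $ i + 1"
    "u \<in> T" "u $ i \<le> x" "x < u $ i + 1"
  shows "u $ j - t $ j \<in> \<int>"
  by (rule interval_tiling_diff_Ints[OF square_tiling_line_section[OF assms(1,2), of x]])
    (use assms(3-) in auto)

lemma square_tiling_separated:
  fixes T :: "(real ^ 2) set"
  assumes "cube_tiling T" "i \<noteq> j" "t \<in> T" "u \<in> T" "t $ j = u $ j" "t $ i < u $ i"
  shows "t $ i + 1 \<le> u $ i"
proof (rule ccontr)
  assume "\<not> t $ i + 1 \<le> u $ i"
  then have "u \<in> cube t"
    unfolding mem_cube_iff using assms(5,6) index_2_cases[OF assms(2)] by (smt (verit))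
  moreover have "u \<in> cube u" by (simp add: mem_cube_iff)
  ultimately have "t = u" using cube_tiling_unique[OF assms(1,3,4)] by blast
  with assms(6) show False by simp
qed

lemma translate_axis_eqI:
  fixes t u :: "real ^ 2"
  assumes "i \<noteq> j" "u $ i = t $ i" "u $ j = t $ j + c"
  shows "t + c *\<^sub>R axis j 1 = u"
  unfolding vec_eq_iff
proof
  fix l
  show "(t + c *\<^sub>R axis j 1) $ l = u $ l"
    using index_2_cases[OF assms(1), of l] assms by (auto simp: axis_def)
qed

text \<open>Picture direction \<open>j\<close> as vertical. By rigidity the line through the left edge of \<open>t\<close> meets a
  square \<open>v\<close> at height \<open>t\<^sub>j + k\<close>. If \<open>v\<close> is not aligned with \<open>t\<close>, then it protrudes to the left.
  Since the line through the right edge of \<open>v\<close> meets \<open>t\<close>, it also carries a square at this same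
  height, which must be the right neighbour of \<open>v\<close>. This neighbour reaches past the right edge of
  \<open>t\<close> and hence meets the edge line of \<open>u\<close>, so \<open>u\<close> is at an integer distance after all.\<close>

lemma column_at_noninteger_shift:
  fixes T :: "(real ^ 2) set"
  assumes T: "cube_tiling T" and ij: "i \<noteq> j" and t: "t \<in> T" and u: "u \<in> T"
    and ui: "u $ i = t $ i + 1" and shift: "u $ j - t $ j \<notin> \<int>"
  shows "t + of_int k *\<^sub>R axis j 1 \<in> T"
proof -
  obtain v where v: "v \<in> T" "v $ i \<le> t $ i" "t $ i < v $ i + 1" "v $ j = t $ j + of_int k"
    using square_tiling_line_shift[OF T ij t, of "t $ i"] by auto
  have "v $ i = t $ i"
  proof (rule ccontr)
    assume "v $ i \<noteq> t $ i"
    then have less: "v $ i < t $ i" using v by simp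
    obtain w where w: "w \<in> T" "w $ i \<le> v $ i + 1" "v $ i + 1 < w $ i + 1"
        "w $ j = t $ j + of_int k"
      using square_tiling_line_shift[OF T ij t, of "v $ i + 1"] v less by auto
    have "v $ i + 1 \<le> w $ i"
      using square_tiling_separated[OF T ij v(1) w(1)] v w by simp
    then have "u $ j - w $ j \<in> \<int>"
      using square_tiling_line_diff_Ints[OF T ij w(1) _ _ u, of "t $ i + 1"] ui v w less by simp
    then have "(u $ j - w $ j) + of_int k \<in> \<int>" by simp
    with w(4) shift show False by simp
  qed
  with translate_axis_eqI[OF ij this v(4)] v(1) show ?thesis by simp
qed

lemma int_sequence_constant:
  fixes f :: "int \<Rightarrow> 'a"
  assumes "\<And>k. f (k + 1) = f k"
  shows "f k = f 0"
proof (induction k rule: int_induct[where k = 0])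
  case (step2 i)
  then show ?case using assms[of "i - 1"] by simp
qed (simp_all add: assms)

theorem theorem4:
  fixes T :: "(real ^ 2) set"
  assumes "cube_tiling T"
  shows "\<exists>(s :: real ^ 2) (i :: 2). \<forall>k :: int. s + of_int k *\<^sub>R axis i 1 \<in> T"
proof -
  have ne: "(1 :: 2) \<noteq> 2" by simp
  obtain t where t: "t \<in> T"
    using assms unfolding cube_tiling_def by blast
  have "\<exists>u. u \<in> T \<and> u $ 2 \<le> t $ 2 \<and> t $ 2 < u $ 2 + 1 \<and> u $ 1 = t $ 1 + of_int k" for k
    using square_tiling_line_shift[OF assms ne[symmetric] t, of "t $ 2"] by auto
  then obtain r where r: "\<And>k. r k \<in> T" "\<And>k. r k $ 2 \<le> t $ 2" "\<And>k. t $ 2 < r k $ 2 + 1"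
      "\<And>k. r k $ 1 = t $ 1 + of_int k"
    by metis
  show ?thesis
  proof (cases "\<forall>k. r (k + 1) $ 2 = r k $ 2")
    case True
    then have const: "r k $ 2 = r 0 $ 2" for k
      using int_sequence_constant[of "\<lambda>k. r k $ 2"] by blast
    have "r 0 + of_int k *\<^sub>R axis 1 1 = r k" for k
      by (rule translate_axis_eqI[OF ne[symmetric] const]) (simp add: r(4))
    with r(1) show ?thesis by metis
  next
    case False
    then obtain k where k: "r (k + 1) $ 2 \<noteq> r k $ 2" by blast
    \<comment> \<open>Both heights lie in the same half-open interval of length 1, so their difference cannot
      be a nonzero integer.\<close>
    have "r (k + 1) $ 2 - r k $ 2 \<notin> \<int>"
    proof
      assume "r (k + 1) $ 2 - r k $ 2 \<in> \<int>"
      moreover have "\<bar>r (k + 1) $ 2 - r k $ 2\<bar> < 1"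
        using r(2,3)[of k] r(2,3)[of "k + 1"] by linarith
      ultimately show False using k Ints_nonzero_abs_less1 by fastforce
    qed
    then have "r k + of_int l *\<^sub>R axis 2 1 \<in> T" for l
      using column_at_noninteger_shift[OF assms ne r(1)[of k] r(1)[of "k + 1"]] r(4) by simp
    then show ?thesis by blast
  qed
qed

end
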